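(* Let $u_{\mathrm{app}}(x)=u^i(x)+u^p(x)$ denote the approximate total field, where $u^i(x)=e^{\mathrm{i}k_m\hat\theta_-\cdot x}$ and $u^p(x)=r(\omega)e^{\mathrm{i}k_m\hat\theta_+\cdot x}$, with $r(\omega)$ the reflection coefficient. Then $u_{\mathrm{app}}$ satisfies the Helmholtz equation in the upper half-space with impedance boundary condition: $$\begin{cases}\Delta u_{\mathrm{app}}+k_m^2u_{\mathrm{app}}=0&\text{in }\mathbb{R}^d_+,\\ u_{\mathrm{app}}+\gamma(\omega)\dfrac{\partial u_{\mathrm{app}}}{\partial x_d}=0&\text{on }\partial\mathbb{R}^d_+,\\ u_{\mathrm{app}}-u^i\ \text{satisfies the outgoing radiation condition as }x_d\to+\infty,\end{cases}$$ where the impedance parameter is $$\gamma(\omega)=\frac{1}{\mathrm{i}\omega\tau_m}\,\frac{1+r(\omega)}{1-r(\omega)}$$ (the quotient being understood for $r(\omega)\neq1$).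
   Context: Let $d\in\{2,3\}$, $x=(x_\ell,x_d)\in\mathbb{R}^{d-1}\times\mathbb{R}$, $\mathbb{R}^d_+=\{x_d>0\}$, $\partial\mathbb{R}^d_+=\{x_d=0\}$. Let $L>0$, $\Lambda=L\mathbb{Z}^{d-1}$, $\Lambda^*=(2\pi/L)\mathbb{Z}^{d-1}$, $Y=[-L/2,L/2]^{d-1}$ (volume $|Y|$), and let $D=\bigcup_{i=1}^ND_i$ be a union of bounded connected domains with $C^2$ boundaries and pairwise disjoint closures contained in the interior of $Y\times(0,\infty)$; $\mathcal{D}=\bigcup_{\xi\in\Lambda}(D+(\xi,0))$. Parameters: wave speeds $v_m>0$, $v_b$, densities $\rho_m,\rho_b$, contrast $\delta=\rho_b/\rho_m$, frequency $\omega>0$, $k_m=\omega/v_m$, $k_b=\omega/v_b$; unit vectors $\hat\theta_\pm=(\hat\theta_\ell,\pm\hat\theta_d)$, $\hat\theta_d>0$; $\alpha=k_m\hat\theta_\ell$, $\tau_m=\hat\theta_d/v_m$; the frequency is low enough that $|\alpha|<k_m<\inf_{\eta\in\Lambda^*\setminus\{0\}}|\alpha+\eta|$. The total field $u$ is the $\alpha$-quasiperiodic solution ($u(x+(\xi,0))=e^{\mathrm{i}\alpha\cdot\xi}u(x)$, $\xi\in\Lambda$) of $\Delta u+k_m^2u=0$ in $\mathbb{R}^d_+\setminus\overline{\mathcal{D}}$, $\Delta u+k_b^2u=0$ in $\mathcal{D}$, with $u$ and $\rho^{-1}\partial u/\partial\nu$ continuous across $\partial\mathcal{D}$ ($\rho=\rho_m$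 outside, $\rho_b$ inside $\mathcal{D}$), $u=0$ on $\partial\mathbb{R}^d_+$, and $u-u^i$ outgoing as $x_d\to+\infty$. Outgoing means: for large $x_d$ a superposition of modes $e^{\mathrm{i}(\alpha+\eta)\cdot x_\ell+\mathrm{i}\sqrt{k_m^2-|\alpha+\eta|^2}\,x_d}$, $\eta\in\Lambda^*$, with the root nonnegative if real and of positive imaginary part otherwise. Above the resonators, $u=u^i+u^p+u^e$, where $u^p=r(\omega)e^{\mathrm{i}k_m\hat\theta_+\cdot x}$ is the (unique) propagating mode of $u-u^i$ and $u^e$ decays exponentially as $x_d\to+\infty$; this defines the reflection coefficient $r(\omega)$. Equivalently $$r(\omega)=-1-\int_{\partial D}\frac{\sin(\omega\tau_my_d)}{\omega\tau_m|Y|}e^{-\mathrm{i}\alpha\cdot y_\ell}\varphi(y)\,d\sigma(y),$$ where $\varphi\in L^2(\partial D)$ is the density with $u=e^{\mathrm{i}k_m\hat\theta_-\cdot x}-e^{\mathrm{i}k_m\hat\theta_+\cdot x}+\int_{\partial D}\big(G_\#^{\alpha,k_m}(x-y)-G_\#^{\alpha,k_m}(x-y^* )\big)\varphi(y)\,d\sigma(y)$ outside $\overline{\mathcal{D}}$, $y^*=(y_\ell,-y_d)$, and $G_\#^{\alpha,k}(x)=\sum_{\eta\in\Lambda^*}\frac{e^{\mathrm{i}(\alpha+\eta)\cdot x_\ell}e^{\mathrm{i}\sqrt{k^2-|\alpha+\eta|^2}|x_d|}}{2\mathrm{i}|Y|\sqrt{k^2-|\alpha+\eta|^2}}$. In $u_{\mathrm{app}}$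 the plane wave $u^p$ is extended to all of $\mathbb{R}^d_+$ by the same formula. *)

theory Defs
  imports "HOL-Analysis.Analysis"
begin

text \<open>
  A point of \<open>\<real>\<^sup>d\<close> is a pair \<open>(x\<^sub>\<ell>, x\<^sub>d)\<close>; the index type \<open>'n\<close> has \<open>d - 1\<close> elements.
  Fields are total functions; they are only ever constrained on the closed upper half-space.
\<close>

type_synonym 'n point = "(real ^ 'n) \<times> real"

definition upper_half_space :: "'n::finite point set" where
  "upper_half_space = {x. snd x > 0}"

definition boundary_plane :: "'n::finite point set" where
  "boundary_plane = {x. snd x = 0}"

definition scaled_int_lattice :: "real \<Rightarrow> (real ^ 'n::finite) set" where
  "scaled_int_lattice c = (\<lambda>z. c *\<^sub>R z) ` {z. \<forall>i. z $ i \<in> \<int>}"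

definition lattice :: "real \<Rightarrow> (real ^ 'n::finite) set" where
  "lattice L = scaled_int_lattice L"

definition dual_lattice :: "real \<Rightarrow> (real ^ 'n::finite) set" where
  "dual_lattice L = scaled_int_lattice (2 * pi / L)"

definition unit_cell :: "real \<Rightarrow> (real ^ 'n::finite) set" where
  "unit_cell L = {y. \<forall>i. - (L / 2) \<le> y $ i \<and> y $ i \<le> L / 2}"

definition periodized :: "real \<Rightarrow> 'n::finite point set \<Rightarrow> 'n point set" where
  "periodized L D = (\<Union>\<xi>\<in>lattice L. (\<lambda>x. x + (\<xi>, 0)) ` D)"

definition C2_on :: "('a::real_normed_vector \<Rightarrow> 'b::real_normed_vector) \<Rightarrow> 'a set \<Rightarrow> bool" where
  "C2_on f S \<longleftrightarrow>
     (\<exists>(f' :: 'a \<Rightarrow> 'a \<Rightarrow>\<^sub>L 'b) (f'' :: 'a \<Rightarrow> 'a \<Rightarrow>\<^sub>L 'a \<Rightarrow>\<^sub>L 'b).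
        (\<forall>x\<in>S. (f has_derivative blinfun_apply (f' x)) (at x)) \<and>
        (\<forall>x\<in>S. (f' has_derivative blinfun_apply (f'' x)) (at x)) \<and>
        continuous_on S f'')"

text \<open>\<open>f\<close> is a regular \<open>C\<^sup>2\<close> function on \<open>U\<close> describing the open set \<open>D\<close> near \<open>p\<close> as \<open>{f < 0}\<close>.\<close>

definition C2_defining_function ::
    "'a::euclidean_space set \<Rightarrow> 'a \<Rightarrow> 'a set \<Rightarrow> ('a \<Rightarrow> real) \<Rightarrow> bool" where
  "C2_defining_function D p U f \<longleftrightarrow>
     open U \<and> p \<in> U \<and> C2_on f U \<and> (\<forall>x\<in>U. \<exists>g. (GDERIV f x :> g) \<and> g \<noteq> 0) \<and>
     D \<inter> U = {x \<in> U. f x < 0}"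

definition C2_boundary :: "'a::euclidean_space set \<Rightarrow> bool" where
  "C2_boundary D \<longleftrightarrow> (\<forall>p\<in>frontier D. \<exists>U f. C2_defining_function D p U f)"

definition outward_unit_normal :: "'a::euclidean_space set \<Rightarrow> 'a \<Rightarrow> 'a \<Rightarrow> bool" where
  "outward_unit_normal D p \<nu> \<longleftrightarrow>
     (\<exists>U f g. C2_defining_function D p U f \<and> (GDERIV f p :> g) \<and> \<nu> = sgn g)"

definition resonators :: "real \<Rightarrow> nat \<Rightarrow> (nat \<Rightarrow> 'n::finite point set) \<Rightarrow> bool" where
  "resonators L N Di \<longleftrightarrow> N \<ge> 1 \<and>
     (\<forall>i\<in>{1..N}. Di i \<noteq> {} \<and> open (Di i) \<and> connected (Di i) \<and> bounded (Di i) \<and>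
        C2_boundary (Di i) \<and> closure (Di i) \<subseteq> interior (unit_cell L \<times> {0<..})) \<and>
     (\<forall>i\<in>{1..N}. \<forall>j\<in>{1..N}. i \<noteq> j \<longrightarrow> closure (Di i) \<inter> closure (Di j) = {})"

definition plane_wave :: "real \<Rightarrow> 'n::finite point \<Rightarrow> 'n point \<Rightarrow> complex" where
  "plane_wave k \<theta> x = exp (\<i> * of_real (k * (\<theta> \<bullet> x)))"

definition laplacian :: "('a::euclidean_space \<Rightarrow> complex) \<Rightarrow> 'a \<Rightarrow> complex" where
  "laplacian f x =
     (\<Sum>b\<in>Basis. frechet_derivative (\<lambda>y. frechet_derivative f (at y) b) (at x) b)"

definition helmholtz_on :: "real \<Rightarrow> 'a::euclidean_space set \<Rightarrow> ('a \<Rightarrow> complex) \<Rightarrow> bool" where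
  "helmholtz_on k \<Omega> u \<longleftrightarrow>
     C2_on u \<Omega> \<and> (\<forall>x\<in>\<Omega>. laplacian u x + (of_real k)\<^sup>2 * u x = 0)"

definition quasiperiodic :: "real \<Rightarrow> real ^ 'n::finite \<Rightarrow> ('n point \<Rightarrow> complex) \<Rightarrow> bool" where
  "quasiperiodic L \<alpha> u \<longleftrightarrow>
     (\<forall>\<xi>\<in>lattice L. \<forall>x. snd x \<ge> 0 \<longrightarrow> u (x + (\<xi>, 0)) = exp (\<i> * of_real (\<alpha> \<bullet> \<xi>)) * u x)"

text \<open>
  On real arguments \<open>csqrt\<close> is exactly the required branch: nonnegative if real, and on
  the positive imaginary axis otherwise.
\<close>

definition mode :: "real ^ 'n::finite \<Rightarrow> real \<Rightarrow> real ^ 'n \<Rightarrow> 'n point \<Rightarrow> complex" where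
  "mode \<alpha> k \<eta> x =
     exp (\<i> * of_real ((\<alpha> + \<eta>) \<bullet> fst x)
        + \<i> * csqrt (of_real (k\<^sup>2 - (norm (\<alpha> + \<eta>))\<^sup>2)) * of_real (snd x))"

definition outgoing ::
    "real \<Rightarrow> real ^ 'n::finite \<Rightarrow> real \<Rightarrow> ('n point \<Rightarrow> complex) \<Rightarrow> bool" where
  "outgoing L \<alpha> k w \<longleftrightarrow>
     (\<exists>h c. \<forall>x. snd x > h \<longrightarrow> ((\<lambda>\<eta>. c \<eta> * mode \<alpha> k \<eta> x) has_sum w x) (dual_lattice L))"

text \<open>
  The fluxes \<open>\<rho>\<^sup>-\<^sup>1 \<partial>u/\<partial>\<nu>\<close> on the two sides of \<open>\<partial>D\<close> are the uniform limits of their values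
  at \<open>p \<plusminus> t \<nu>(p)\<close> as \<open>t\<close> decreases to 0.
\<close>

definition flux_continuous_across ::
    "real \<Rightarrow> real \<Rightarrow> 'a::euclidean_space set \<Rightarrow> ('a \<Rightarrow> complex) \<Rightarrow> bool" where
  "flux_continuous_across \<rho>out \<rho>in D u \<longleftrightarrow>
     (\<exists>\<nu> g. (\<forall>p\<in>frontier D. outward_unit_normal D p (\<nu> p)) \<and>
        uniform_limit (frontier D)
          (\<lambda>t p. frechet_derivative u (at (p + t *\<^sub>R \<nu> p)) (\<nu> p) / of_real \<rho>out) g (at_right 0) \<and>
        uniform_limit (frontier D)
          (\<lambda>t p. frechet_derivative u (at (p - t *\<^sub>R \<nu> p)) (\<nu> p) / of_real \<rho>in) g (at_right 0))"

text \<open>Continuity on the closed half-space contains the continuity of \<open>u\<close> across \<open>\<partial>D\<close>.\<close>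

definition total_field ::
    "real \<Rightarrow> 'n::finite point set \<Rightarrow> real \<Rightarrow> real \<Rightarrow> real \<Rightarrow> real \<Rightarrow> real ^ 'n
      \<Rightarrow> ('n point \<Rightarrow> complex) \<Rightarrow> ('n point \<Rightarrow> complex) \<Rightarrow> bool" where
  "total_field L D km kb \<rho>m \<rho>b \<alpha> ui u \<longleftrightarrow>
     quasiperiodic L \<alpha> u \<and>
     helmholtz_on km (upper_half_space - closure (periodized L D)) u \<and>
     helmholtz_on kb (periodized L D) u \<and>
     continuous_on (upper_half_space \<union> boundary_plane) u \<and>
     flux_continuous_across \<rho>m \<rho>b (periodized L D) u \<and>
     (\<forall>x\<in>boundary_plane. u x = 0) \<and>
     outgoing L \<alpha> km (\<lambda>x. u x - ui x)"

definition exp_decaying :: "('n::finite point \<Rightarrow> complex) \<Rightarrow> bool" where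
  "exp_decaying w \<longleftrightarrow>
     (\<exists>C \<kappa> h. \<kappa> > 0 \<and> (\<forall>x. snd x > h \<longrightarrow> norm (w x) \<le> C * exp (- \<kappa> * snd x)))"

definition reflection_coefficient ::
    "real \<Rightarrow> 'n::finite point \<Rightarrow> ('n point \<Rightarrow> complex) \<Rightarrow> ('n point \<Rightarrow> complex) \<Rightarrow> complex" where
  "reflection_coefficient k \<theta>plus ui u =
     (THE r. exp_decaying (\<lambda>x. u x - ui x - r * plane_wave k \<theta>plus x))"

definition impedance :: "real \<Rightarrow> real \<Rightarrow> complex \<Rightarrow> complex" where
  "impedance \<omega> \<tau> r = 1 / (\<i> * of_real (\<omega> * \<tau>)) * ((1 + r) / (1 - r))"

lemma zero_in_dual_lattice: "0 \<in> dual_lattice L"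
  unfolding dual_lattice_def scaled_int_lattice_def
  by (rule image_eqI[of _ _ 0]) auto

lemma mode_0_eq_plane_wave:
  fixes \<theta>l :: "real ^ 'n::finite"
  assumes "k > 0" "\<theta>d > 0" "norm (\<theta>l, \<theta>d) = 1"
  shows "mode (k *\<^sub>R \<theta>l) k 0 = plane_wave k (\<theta>l, \<theta>d)"
proof
  fix x :: "'n point"
  have "(norm \<theta>l)\<^sup>2 + \<theta>d\<^sup>2 = 1"
    using assms(3) by (simp add: norm_Pair)
  then have "k\<^sup>2 - (norm (k *\<^sub>R \<theta>l + 0))\<^sup>2 = (k * \<theta>d)\<^sup>2"
    by (simp add: power_mult_distrib) (metis add_diff_cancel_left' mult.right_neutral right_diff_distrib)
  moreover have "csqrt (of_real ((k * \<theta>d)\<^sup>2)) = of_real (k * \<theta>d)"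
    using assms by (simp add: csqrt_of_real_nonneg real_sqrt_unique)
  ultimately have "csqrt (of_real (k\<^sup>2 - (norm (k *\<^sub>R \<theta>l + 0))\<^sup>2)) = of_real (k * \<theta>d)"
    by simp
  then show "mode (k *\<^sub>R \<theta>l) k 0 x = plane_wave k (\<theta>l, \<theta>d) x"
    unfolding mode_def plane_wave_def
    by (cases x) (simp add: algebra_simps inner_Pair)
qed

lemma norm_plane_wave [simp]: "norm (plane_wave k \<theta> x) = 1"
  by (simp add: plane_wave_def)

lemma norm_evanescent_mode:
  assumes "k\<^sup>2 \<le> (norm (\<alpha> + \<eta>))\<^sup>2"
  shows "norm (mode \<alpha> k \<eta> x) = exp (- sqrt ((norm (\<alpha> + \<eta>))\<^sup>2 - k\<^sup>2) * snd x)"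
proof -
  have "csqrt (of_real (k\<^sup>2 - (norm (\<alpha> + \<eta>))\<^sup>2)) = \<i> * sqrt ((norm (\<alpha> + \<eta>))\<^sup>2 - k\<^sup>2)"
    using assms by (subst csqrt_of_real_nonpos) (auto simp: abs_if)
  then show ?thesis
    unfolding mode_def by (simp add: norm_exp_eq_Re)
qed

text \<open>
  Well-definedness of the reflection coefficient: below the first diffraction threshold,
  an outgoing field is a unique multiple of the propagating mode plus a decaying remainder.
\<close>

lemma reflection_coefficient_ex1:
  fixes \<theta>l :: "real ^ 'n::finite"
  assumes k: "k > 0" and \<theta>: "\<theta>d > 0" "norm (\<theta>l, \<theta>d) = 1"
    and low: "k < (INF \<eta>\<in>dual_lattice L - {0}. norm (k *\<^sub>R \<theta>l + \<eta>))"
    and out: "outgoing L (k *\<^sub>R \<theta>l) k (\<lambda>x. u x - ui x)"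
  shows "\<exists>!r. exp_decaying (\<lambda>x. u x - ui x - r * plane_wave k (\<theta>l, \<theta>d) x)"
proof -
  let ?\<alpha> = "k *\<^sub>R \<theta>l" and ?\<Lambda> = "dual_lattice L :: (real ^ 'n) set"
  let ?p = "plane_wave k (\<theta>l, \<theta>d)"
  define m where "m = (INF \<eta>\<in>?\<Lambda> - {0}. norm (?\<alpha> + \<eta>))"
  define \<kappa> where "\<kappa> = sqrt (m\<^sup>2 - k\<^sup>2)"
  have mk: "k < m" using low by (simp add: m_def)
  have \<kappa>: "\<kappa> > 0"
    unfolding \<kappa>_def using mk k by (simp add: power_strict_mono)
  have m_le: "m \<le> norm (?\<alpha> + \<eta>)" if "\<eta> \<in> ?\<Lambda> - {0}" for \<eta>
    unfolding m_def by (rule cINF_lower[OF _ that]) (auto intro!: bdd_belowI[of _ 0])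
  have m2: "m\<^sup>2 \<le> (norm (?\<alpha> + \<eta>))\<^sup>2" if "\<eta> \<in> ?\<Lambda> - {0}" for \<eta>
    using m_le[OF that] mk k by (intro power_mono) auto
  have k2: "k\<^sup>2 \<le> m\<^sup>2"
    using mk k by (intro power_mono) auto
  obtain h c where hs: "\<And>x. snd x > h \<Longrightarrow>
      ((\<lambda>\<eta>. c \<eta> * mode ?\<alpha> k \<eta> x) has_sum (u x - ui x)) ?\<Lambda>"
    using out unfolding outgoing_def by blast
  have rest: "((\<lambda>\<eta>. c \<eta> * mode ?\<alpha> k \<eta> x) has_sum (u x - ui x - c 0 * ?p x)) (?\<Lambda> - {0})"
    if "snd x > h" for x
  proof -
    have "((\<lambda>\<eta>. c \<eta> * mode ?\<alpha> k \<eta> x) has_sum c 0 * ?p x) {0}"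
      using mode_0_eq_plane_wave[OF k \<theta>] has_sum_finite[of "{0}" "\<lambda>\<eta>. c \<eta> * mode ?\<alpha> k \<eta> x"]
      by simp
    from has_sum_Diff[OF hs[OF that] this] show ?thesis
      using zero_in_dual_lattice by auto
  qed
  define x0 :: "'n point" where "x0 = (0, h + 1)"
  define F where "F = (\<lambda>\<eta>. norm (c \<eta> * mode ?\<alpha> k \<eta> x0))"
  have Fs: "F summable_on (?\<Lambda> - {0})"
    unfolding F_def using rest[of x0]
    by (auto simp: x0_def summable_on_iff_abs_summable_on_complex[symmetric] summable_on_def)
  have bound: "norm (u x - ui x - c 0 * ?p x) \<le>
      (infsum F (?\<Lambda> - {0}) * exp (\<kappa> * (h + 1))) * exp (- \<kappa> * snd x)" if x: "snd x > h + 1" for x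
  proof -
    let ?E = "exp (- \<kappa> * (snd x - (h + 1)))"
    have le: "norm (c \<eta> * mode ?\<alpha> k \<eta> x) \<le> F \<eta> * ?E" if \<eta>: "\<eta> \<in> ?\<Lambda> - {0}" for \<eta>
    proof -
      define s where "s = sqrt ((norm (?\<alpha> + \<eta>))\<^sup>2 - k\<^sup>2)"
      have "\<kappa> \<le> s" unfolding \<kappa>_def s_def using m2[OF \<eta>] by simp
      then have "\<kappa> * (snd x - (h + 1)) \<le> s * (snd x - (h + 1))"
        using x by (intro mult_right_mono) auto
      then have "- s * snd x \<le> - s * (h + 1) + - \<kappa> * (snd x - (h + 1))"
        by (simp add: algebra_simps)
      then have "exp (- s * snd x) \<le> exp (- s * (h + 1)) * ?E"
        by (simp add: exp_add[symmetric])
      moreover have "k\<^sup>2 \<le> (norm (?\<alpha> + \<eta>))\<^sup>2" using m2[OF \<eta>] k2 by linarith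
      ultimately have "norm (mode ?\<alpha> k \<eta> x) \<le> norm (mode ?\<alpha> k \<eta> x0) * ?E"
        by (simp add: norm_evanescent_mode s_def x0_def)
      then show ?thesis
        unfolding F_def norm_mult by (simp add: mult.assoc mult_left_mono)
    qed
    have FE: "(\<lambda>\<eta>. F \<eta> * ?E) summable_on (?\<Lambda> - {0})"
      by (rule summable_on_cmult_left[OF Fs])
    have "(\<lambda>\<eta>. c \<eta> * mode ?\<alpha> k \<eta> x) summable_on (?\<Lambda> - {0})"
      using rest[of x] x by (auto simp: summable_on_def)
    then have ab: "(\<lambda>\<eta>. norm (c \<eta> * mode ?\<alpha> k \<eta> x)) summable_on (?\<Lambda> - {0})"
      by (simp only: summable_on_iff_abs_summable_on_complex[symmetric])
    have "norm (u x - ui x - c 0 * ?p x) = norm (\<Sum>\<^sub>\<infinity>\<eta>\<in>?\<Lambda> - {0}. c \<eta> * mode ?\<alpha> k \<eta> x)"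
      using infsumI[OF rest[of x]] x by simp
    also have "\<dots> \<le> (\<Sum>\<^sub>\<infinity>\<eta>\<in>?\<Lambda> - {0}. norm (c \<eta> * mode ?\<alpha> k \<eta> x))"
      by (rule norm_infsum_bound[OF ab])
    also have "\<dots> \<le> (\<Sum>\<^sub>\<infinity>\<eta>\<in>?\<Lambda> - {0}. F \<eta> * ?E)"
      by (rule infsum_mono[OF ab FE le])
    also have "\<dots> = infsum F (?\<Lambda> - {0}) * ?E"
      by (rule infsum_cmult_left) (use Fs in auto)
    also have "?E = exp (\<kappa> * (h + 1)) * exp (- \<kappa> * snd x)"
      by (simp add: exp_add[symmetric] algebra_simps)
    finally show ?thesis by (simp add: mult.assoc)
  qed
  show ?thesis
  proof (rule ex1I[of _ "c 0"])
    show "exp_decaying (\<lambda>x. u x - ui x - c 0 * ?p x)"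
      unfolding exp_decaying_def using bound \<kappa> by blast
  next
    fix r assume "exp_decaying (\<lambda>x. u x - ui x - r * ?p x)"
    then obtain C' \<kappa>' h' where \<kappa>': "\<kappa>' > 0"
      and b': "\<And>x. snd x > h' \<Longrightarrow> norm (u x - ui x - r * ?p x) \<le> C' * exp (- \<kappa>' * snd x)"
      unfolding exp_decaying_def by blast
    define C where "C = infsum F (?\<Lambda> - {0}) * exp (\<kappa> * (h + 1))"
    have "norm (r - c 0) \<le> C' * exp (- \<kappa>' * t) + C * exp (- \<kappa> * t)"
      if "t > max h' (h + 1)" for t
    proof -
      let ?x = "(0, t) :: 'n point"
      have "norm (r - c 0) = norm ((r - c 0) * ?p ?x)" by (simp add: norm_mult)
      also have "(r - c 0) * ?p ?x = (u ?x - ui ?x - c 0 * ?p ?x) - (u ?x - ui ?x - r * ?p ?x)"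
        by (simp add: algebra_simps)
      also have "norm \<dots> \<le> norm (u ?x - ui ?x - c 0 * ?p ?x) + norm (u ?x - ui ?x - r * ?p ?x)"
        by (rule norm_triangle_ineq4)
      finally show ?thesis using bound[of ?x] b'[of ?x] that unfolding C_def by force
    qed
    then have ev: "eventually (\<lambda>t. norm (r - c 0) \<le> C' * exp (- \<kappa>' * t) + C * exp (- \<kappa> * t)) at_top"
      using eventually_gt_at_top by (rule eventually_mono[rotated])
    have lim: "((\<lambda>t::real. A * exp (- a * t)) \<longlongrightarrow> 0) at_top" if "a > 0" for A a :: real
    proof -
      have "filterlim (\<lambda>t::real. a * t) at_top at_top"
        by (rule filterlim_tendsto_pos_mult_at_top[OF tendsto_const that filterlim_ident])
      then have "((\<lambda>t::real. exp (- (a * t))) \<longlongrightarrow> 0) at_top"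
        by (intro filterlim_compose[OF exp_at_bot] filterlim_compose[OF filterlim_uminus_at_bot_at_top])
      from tendsto_mult_right_zero[OF this, of A] show ?thesis by simp
    qed
    have "((\<lambda>t. C' * exp (- \<kappa>' * t) + C * exp (- \<kappa> * t)) \<longlongrightarrow> 0 + 0) at_top"
      by (intro tendsto_add lim \<kappa> \<kappa>')
    from tendsto_lowerbound[OF this ev] have "norm (r - c 0) \<le> 0" by simp
    then show "r = c 0" by simp
  qed
qed

end

theory Submission
  imports Defs
begin

text \<open>
  The approximate field is a combination of two plane waves.  A plane wave with unit direction
  \<open>\<theta>\<close> solves the Helmholtz equation, since its Laplacian is \<open>(\<i>k)\<^sup>2 |\<theta>|\<^sup>2\<close> times itself, and the
  solutions on an open set form a complex vector space; so the incident wave plus \<open>r\<close> times the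
  upgoing wave is a solution.

  On \<open>x\<^sub>d = 0\<close> the incident and upgoing waves have the same trace \<open>E\<close>, while their normal
  derivatives are opposite: the trace of the approximate field is \<open>(1 + r) E\<close> and its normal
  derivative is \<open>- \<i>k\<theta>\<^sub>d (1 - r) E\<close>.  For \<open>r \<noteq> 1\<close> the ratio of the two
  does not depend on the boundary point, and, as \<open>k\<^sub>m \<theta>\<^sub>d = \<omega> \<tau>\<^sub>m\<close>, it is \<open>- \<gamma>\<close>.

  Finally \<open>\<alpha>\<close> is the tangential wave vector of the upgoing wave, which is therefore the mode
  \<open>\<eta> = 0\<close> of the radiation condition, with all other coefficients zero.
\<close>

section \<open>The Laplacian of twice continuously differentiable functions\<close>

text \<open>
  The iterated directional derivatives that define the Laplacian are entries of the second
  derivative.  Openness of \<open>S\<close> matters: the first derivative has to be known on a whole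
  neighbourhood of \<open>x\<close> before it can be differentiated.
\<close>

lemma laplacian_eq_trace_second_derivative:
  fixes f :: "'a::euclidean_space \<Rightarrow> complex"
    and f' :: "'a \<Rightarrow> 'a \<Rightarrow>\<^sub>L complex" and f'' :: "'a \<Rightarrow> 'a \<Rightarrow>\<^sub>L 'a \<Rightarrow>\<^sub>L complex"
  assumes "open S" "x \<in> S"
    and f': "\<And>y. y \<in> S \<Longrightarrow> (f has_derivative blinfun_apply (f' y)) (at y)"
    and f'': "(f' has_derivative blinfun_apply (f'' x)) (at x)"
  shows "laplacian f x = (\<Sum>b\<in>Basis. blinfun_apply (blinfun_apply (f'' x) b) b)"
  unfolding laplacian_def
proof (rule sum.cong[OF refl])
  fix b :: 'a
  have "((\<lambda>y. blinfun_apply (f' y) b) has_derivative (\<lambda>h. blinfun_apply (blinfun_apply (f'' x) h) b)) (at x)"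
    by (rule bounded_linear.has_derivative[OF blinfun.bounded_linear_left f''])
  moreover have "blinfun_apply (f' y) b = frechet_derivative f (at y) b" if "y \<in> S" for y
    using frechet_derivative_at[OF f'[OF that]] by simp
  ultimately have "((\<lambda>y. frechet_derivative f (at y) b) has_derivative
      (\<lambda>h. blinfun_apply (blinfun_apply (f'' x) h) b)) (at x)"
    by (rule has_derivative_transform_within_open[OF _ assms(1,2)])
  then show "frechet_derivative (\<lambda>y. frechet_derivative f (at y) b) (at x) b =
      blinfun_apply (blinfun_apply (f'' x) b) b"
    by (simp flip: frechet_derivative_at)
qed

lemma C2_onI:
  assumes "\<And>x. x \<in> S \<Longrightarrow> (f has_derivative blinfun_apply (f' x)) (at x)"
    and "\<And>x. x \<in> S \<Longrightarrow> (f' has_derivative blinfun_apply (f'' x)) (at x)"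
    and "continuous_on S f''"
  shows "C2_on f S"
  unfolding C2_on_def using assms by (intro exI[of _ f'] exI[of _ f''] conjI ballI)

section \<open>Solutions of the Helmholtz equation form a complex vector space\<close>

lemma helmholtz_on_add:
  assumes "open S" "helmholtz_on k S f" "helmholtz_on k S g"
  shows "helmholtz_on k S (\<lambda>x. f x + g x)"
proof -
  obtain f' f'' where f: "\<And>x. x \<in> S \<Longrightarrow> (f has_derivative blinfun_apply (f' x)) (at x)"
      "\<And>x. x \<in> S \<Longrightarrow> (f' has_derivative blinfun_apply (f'' x)) (at x)" "continuous_on S f''"
    using assms(2) unfolding helmholtz_on_def C2_on_def by blast
  obtain g' g'' where g: "\<And>x. x \<in> S \<Longrightarrow> (g has_derivative blinfun_apply (g' x)) (at x)"
      "\<And>x. x \<in> S \<Longrightarrow> (g' has_derivative blinfun_apply (g'' x)) (at x)" "continuous_on S g''"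
    using assms(3) unfolding helmholtz_on_def C2_on_def by blast
  have 1: "((\<lambda>x. f x + g x) has_derivative blinfun_apply (f' x + g' x)) (at x)" if "x \<in> S" for x
    using has_derivative_add[OF f(1)[OF that] g(1)[OF that]] by (simp add: plus_blinfun.rep_eq)
  have 2: "((\<lambda>x. f' x + g' x) has_derivative blinfun_apply (f'' x + g'' x)) (at x)" if "x \<in> S" for x
    using has_derivative_add[OF f(2)[OF that] g(2)[OF that]] by (simp add: plus_blinfun.rep_eq)
  have "laplacian (\<lambda>x. f x + g x) x = laplacian f x + laplacian g x" if "x \<in> S" for x
  proof -
    have "laplacian f x = (\<Sum>b\<in>Basis. blinfun_apply (blinfun_apply (f'' x) b) b)"
      using that by (intro laplacian_eq_trace_second_derivative[OF assms(1), of _ _ f'] f)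
    moreover have "laplacian g x = (\<Sum>b\<in>Basis. blinfun_apply (blinfun_apply (g'' x) b) b)"
      using that by (intro laplacian_eq_trace_second_derivative[OF assms(1), of _ _ g'] g)
    moreover have "laplacian (\<lambda>x. f x + g x) x =
        (\<Sum>b\<in>Basis. blinfun_apply (blinfun_apply (f'' x + g'' x) b) b)"
      using that by (intro laplacian_eq_trace_second_derivative[OF assms(1), of _ _ "\<lambda>x. f' x + g' x"] 1 2)
    ultimately show ?thesis
      by (simp add: blinfun.add_left sum.distrib)
  qed
  then have "laplacian (\<lambda>x. f x + g x) x + (of_real k)\<^sup>2 * (f x + g x) =
      (laplacian f x + (of_real k)\<^sup>2 * f x) + (laplacian g x + (of_real k)\<^sup>2 * g x)" if "x \<in> S" for x
    using that by (simp add: algebra_simps)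
  then have "laplacian (\<lambda>x. f x + g x) x + (of_real k)\<^sup>2 * (f x + g x) = 0" if "x \<in> S" for x
    using assms(2,3) that unfolding helmholtz_on_def by simp
  moreover have "C2_on (\<lambda>x. f x + g x) S"
    by (rule C2_onI[OF 1 2 continuous_on_add[OF f(3) g(3)]])
  ultimately show ?thesis
    unfolding helmholtz_on_def by blast
qed

lemma helmholtz_on_cmult:
  assumes "open S" "helmholtz_on k S f"
  shows "helmholtz_on k S (\<lambda>x. c * f x)"
proof -
  obtain f' f'' where f: "\<And>x. x \<in> S \<Longrightarrow> (f has_derivative blinfun_apply (f' x)) (at x)"
      "\<And>x. x \<in> S \<Longrightarrow> (f' has_derivative blinfun_apply (f'' x)) (at x)" "continuous_on S f''"
    using assms(2) unfolding helmholtz_on_def C2_on_def by blast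
  (* M is multiplication by c on the space of derivatives: f' becomes M f' pointwise, and by the
     chain rule f'' becomes its composition with M. *)
  define M :: "('a \<Rightarrow>\<^sub>L complex) \<Rightarrow>\<^sub>L ('a \<Rightarrow>\<^sub>L complex)"
    where "M = Blinfun (\<lambda>T. blinfun_mult_right c o\<^sub>L T)"
  have M: "blinfun_apply M T = blinfun_mult_right c o\<^sub>L T" for T
    unfolding M_def by (simp add: bounded_linear_Blinfun_apply bounded_bilinear.bounded_linear_right
        bounded_bilinear_blinfun_compose)
  have 1: "((\<lambda>x. c * f x) has_derivative blinfun_apply (blinfun_apply M (f' x))) (at x)"
    if "x \<in> S" for x
    using has_derivative_mult_right[OF f(1)[OF that], of c] by (simp add: M o_def blinfun_compose.rep_eq)
  have 2: "((\<lambda>x. blinfun_apply M (f' x)) has_derivative blinfun_apply (M o\<^sub>L f'' x)) (at x)"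
    if "x \<in> S" for x
    using bounded_linear.has_derivative[OF blinfun.bounded_linear_right f(2)[OF that], of M]
    by (simp add: o_def blinfun_compose.rep_eq)
  have 3: "continuous_on S (\<lambda>x. M o\<^sub>L f'' x)"
    by (intro bounded_bilinear.continuous_on[OF bounded_bilinear_blinfun_compose]
        continuous_on_const f(3))
  have "laplacian (\<lambda>x. c * f x) x + (of_real k)\<^sup>2 * (c * f x) = 0" if "x \<in> S" for x
  proof -
    have "laplacian f x = (\<Sum>b\<in>Basis. blinfun_apply (blinfun_apply (f'' x) b) b)"
      using that by (intro laplacian_eq_trace_second_derivative[OF assms(1), of _ _ f'] f)
    moreover have "laplacian (\<lambda>x. c * f x) x =
        (\<Sum>b\<in>Basis. blinfun_apply (blinfun_apply (M o\<^sub>L f'' x) b) b)"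
      using that by (intro laplacian_eq_trace_second_derivative[OF assms(1), of _ _ "\<lambda>x. blinfun_apply M (f' x)"] 1 2)
    ultimately have "laplacian (\<lambda>x. c * f x) x + (of_real k)\<^sup>2 * (c * f x) =
        c * (laplacian f x + (of_real k)\<^sup>2 * f x)"
      by (simp add: M sum_distrib_left algebra_simps)
    then show ?thesis
      using assms(2) that unfolding helmholtz_on_def by simp
  qed
  moreover have "C2_on (\<lambda>x. c * f x) S"
    by (rule C2_onI[OF 1 2 3])
  ultimately show ?thesis
    unfolding helmholtz_on_def by blast
qed

section \<open>Plane waves\<close>

lemma bounded_linear_phase: "bounded_linear (\<lambda>h. \<i> * of_real (k * (\<theta> \<bullet> h)) :: complex)"
  by (rule bounded_linear_const_mult[OF bounded_linear_compose[OF bounded_linear_of_real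
        bounded_linear_const_mult[OF bounded_linear_inner_right]]])

lemma has_derivative_plane_wave:
  "(plane_wave k \<theta> has_derivative (\<lambda>h. \<i> * of_real (k * (\<theta> \<bullet> h)) * plane_wave k \<theta> x)) (at x)"
proof -
  have "((\<lambda>x. \<i> * of_real (k * (\<theta> \<bullet> x))) has_derivative (\<lambda>h. \<i> * of_real (k * (\<theta> \<bullet> h)))) (at x)"
    by (rule bounded_linear_imp_has_derivative[OF bounded_linear_phase])
  from has_derivative_compose[OF this DERIV_exp[unfolded has_field_derivative_def]] show ?thesis
    unfolding plane_wave_def by (simp only: mult.commute)
qed

lemma helmholtz_on_plane_wave:
  assumes "open S" "norm \<theta> = 1"
  shows "helmholtz_on k S (plane_wave k \<theta>)"
proof -
  let ?p = "plane_wave k \<theta>"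
  (* With M z = z A, differentiating the wave is composing it with the linear map M.  The
     second derivative then comes from the first by the chain rule for a bounded linear map. *)
  define A :: "'a point \<Rightarrow>\<^sub>L complex" where "A = Blinfun (\<lambda>h. \<i> * of_real (k * (\<theta> \<bullet> h)))"
  have A: "blinfun_apply A h = \<i> * of_real (k * (\<theta> \<bullet> h))" for h
    unfolding A_def by (simp only: bounded_linear_Blinfun_apply[OF bounded_linear_phase])
  define M :: "complex \<Rightarrow>\<^sub>L 'a point \<Rightarrow>\<^sub>L complex"
    where "M = Blinfun (\<lambda>z. blinfun_mult_right z o\<^sub>L A)"
  have M: "blinfun_apply M z = blinfun_mult_right z o\<^sub>L A" for z
    unfolding M_def
    by (simp only: bounded_linear_Blinfun_apply[OF bounded_linear_compose[OF
            bounded_bilinear.bounded_linear_left[OF bounded_bilinear_blinfun_compose]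
            bounded_linear_blinfun_mult_right]])
  have 1: "(?p has_derivative blinfun_apply (blinfun_apply M (?p x))) (at x)" for x
    using has_derivative_plane_wave[of k \<theta> x] by (simp add: M A o_def mult.commute blinfun_compose.rep_eq)
  have 2: "((\<lambda>x. blinfun_apply M (?p x)) has_derivative
      blinfun_apply (M o\<^sub>L blinfun_apply M (?p x))) (at x)" for x
    using bounded_linear.has_derivative[OF blinfun.bounded_linear_right 1, of M]
    by (simp add: o_def blinfun_compose.rep_eq)
  have "continuous_on S ?p"
    unfolding plane_wave_def by (intro continuous_intros)
  then have 3: "continuous_on S (\<lambda>x. M o\<^sub>L blinfun_apply M (?p x))"
    by (intro bounded_bilinear.continuous_on[OF bounded_bilinear_blinfun_compose]
        continuous_on_const bounded_linear.continuous_on[OF blinfun.bounded_linear_right])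
  have "laplacian ?p x = - (of_real k)\<^sup>2 * ?p x" if "x \<in> S" for x
  proof -
    have "laplacian ?p x = (\<Sum>b\<in>Basis. - (of_real k)\<^sup>2 * ?p x * of_real ((\<theta> \<bullet> b) * (\<theta> \<bullet> b)))"
      by (subst laplacian_eq_trace_second_derivative[where f' = "\<lambda>x. blinfun_apply M (?p x)" and
            f'' = "\<lambda>x. M o\<^sub>L blinfun_apply M (?p x)", OF assms(1) that 1 2])
        (simp add: M A power2_eq_square mult_ac)
    also have "\<dots> = - (of_real k)\<^sup>2 * ?p x * of_real (\<theta> \<bullet> \<theta>)"
      unfolding euclidean_inner[of \<theta> \<theta>] of_real_sum by (rule sum_distrib_left[symmetric])
    also have "\<theta> \<bullet> \<theta> = 1"
      using assms(2) by (simp add: dot_square_norm)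
    finally show ?thesis by simp
  qed
  then show ?thesis
    unfolding helmholtz_on_def using C2_onI[OF 1 2 3] by simp
qed

section \<open>The impedance condition\<close>

text \<open>
  The two waves \<open>(\<theta>\<^sub>l, \<plusminus> \<theta>\<^sub>d)\<close> agree on the boundary plane because only their tangential phase
  survives there, so the trace and the normal derivative of any combination are multiples of
  one and the same function; the impedance is minus the ratio of the first multiple to the second.
\<close>

lemma impedance_condition_incident_plus_reflected:
  fixes \<theta>l :: "real ^ 'n::finite"
  assumes x: "x \<in> boundary_plane" and r: "r \<noteq> 1" and \<tau>: "\<omega> * \<tau> = k * \<theta>d" "k * \<theta>d \<noteq> 0"
  defines "f \<equiv> \<lambda>x. plane_wave k (\<theta>l, - \<theta>d) x + r * plane_wave k (\<theta>l, \<theta>d) x"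
  shows "f x + impedance \<omega> \<tau> r * frechet_derivative f (at x) (0, 1) = 0"
proof -
  let ?E = "plane_wave k (\<theta>l, \<theta>d) x"
  have E: "plane_wave k (\<theta>l, - \<theta>d) x = ?E"
    using x by (cases x) (simp add: plane_wave_def boundary_plane_def inner_Pair)
  have ratio: "impedance \<omega> \<tau> r * (\<i> * of_real (k * \<theta>d) * (1 - r)) = 1 + r"
    unfolding impedance_def \<tau>(1) using r \<tau>(2) by simp
  have "(f has_derivative (\<lambda>h. \<i> * of_real (k * ((\<theta>l, - \<theta>d) \<bullet> h)) * plane_wave k (\<theta>l, - \<theta>d) x
      + r * (\<i> * of_real (k * ((\<theta>l, \<theta>d) \<bullet> h)) * ?E))) (at x)"
    unfolding f_def
    by (intro has_derivative_add has_derivative_mult_right has_derivative_plane_wave)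
  from frechet_derivative_at[OF this, symmetric]
  have "frechet_derivative f (at x) (0, 1) = - (\<i> * of_real (k * \<theta>d)) * (1 - r) * ?E"
    by (simp add: E inner_Pair algebra_simps)
  moreover have "f x = (1 + r) * ?E"
    by (simp add: f_def E algebra_simps)
  ultimately have "f x + impedance \<omega> \<tau> r * frechet_derivative f (at x) (0, 1) =
      (1 + r) * ?E - impedance \<omega> \<tau> r * (\<i> * of_real (k * \<theta>d) * (1 - r)) * ?E"
    by (simp only: mult.assoc mult_minus_left mult_minus_right add_uminus_conv_diff)
  also have "\<dots> = 0"
    unfolding ratio by simp
  finally show ?thesis .
qed

section \<open>The radiation condition\<close>

lemma outgoing_single_mode:
  assumes "\<eta> \<in> dual_lattice L"
  shows "outgoing L \<alpha> k (\<lambda>x. a * mode \<alpha> k \<eta> x)"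
proof -
  define c where "c = (\<lambda>\<zeta>. if \<zeta> = \<eta> then a else 0)"
  have "((\<lambda>\<zeta>. c \<zeta> * mode \<alpha> k \<zeta> x) has_sum a * mode \<alpha> k \<eta> x) (dual_lattice L)" for x
  proof -
    have "((\<lambda>\<zeta>. c \<zeta> * mode \<alpha> k \<zeta> x) has_sum a * mode \<alpha> k \<eta> x) {\<eta>}"
      using has_sum_finite[of "{\<eta>}" "\<lambda>\<zeta>. c \<zeta> * mode \<alpha> k \<zeta> x"] by (simp add: c_def)
    also have "?this \<longleftrightarrow> ?thesis"
      using assms by (intro has_sum_cong_neutral) (auto simp: c_def)
    finally show ?thesis .
  qed
  then show ?thesis
    unfolding outgoing_def by (intro exI[of _ 0] exI[of _ c] allI impI)
qed

section \<open>The approximate total field\<close>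

theorem proposition3p2:
  fixes d :: nat
    and L v\<^sub>m v\<^sub>b \<rho>\<^sub>m \<rho>\<^sub>b \<omega> k\<^sub>m k\<^sub>b \<theta>\<^sub>d \<tau>\<^sub>m :: real
    and \<theta>\<^sub>l \<alpha> :: "real ^ 'n::finite"
    and \<theta>\<^sub>p \<theta>\<^sub>n :: "'n point"
    and N :: nat and Di :: "nat \<Rightarrow> 'n point set" and D :: "'n point set"
    and u u\<^sub>i u\<^sub>p u\<^sub>a\<^sub>p\<^sub>p :: "'n point \<Rightarrow> complex"
    and r \<gamma> :: complex
  assumes dim: "CARD('n) = d - 1" "d \<in> {2, 3}"
    and L: "L > 0"
    and geometry: "resonators L N Di" "D = (\<Union>i\<in>{1..N}. Di i)"
    and material: "v\<^sub>m > 0" "v\<^sub>b \<noteq> 0" "\<rho>\<^sub>m \<noteq> 0" "\<rho>\<^sub>b \<noteq> 0"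
    and frequency: "\<omega> > 0" "k\<^sub>m = \<omega> / v\<^sub>m" "k\<^sub>b = \<omega> / v\<^sub>b"
    and direction: "\<theta>\<^sub>p = (\<theta>\<^sub>l, \<theta>\<^sub>d)" "\<theta>\<^sub>n = (\<theta>\<^sub>l, - \<theta>\<^sub>d)" "norm \<theta>\<^sub>p = 1" "norm \<theta>\<^sub>n = 1" "\<theta>\<^sub>d > 0"
    and \<alpha>: "\<alpha> = k\<^sub>m *\<^sub>R \<theta>\<^sub>l"
    and \<tau>: "\<tau>\<^sub>m = \<theta>\<^sub>d / v\<^sub>m"
    and low_frequency: "norm \<alpha> < k\<^sub>m" "k\<^sub>m < (INF \<eta>\<in>dual_lattice L - {0}. norm (\<alpha> + \<eta>))"
    and incident: "u\<^sub>i = plane_wave k\<^sub>m \<theta>\<^sub>n"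
    and field: "total_field L D k\<^sub>m k\<^sub>b \<rho>\<^sub>m \<rho>\<^sub>b \<alpha> u\<^sub>i u"
    and reflection: "r = reflection_coefficient k\<^sub>m \<theta>\<^sub>p u\<^sub>i u"
    and reflected: "u\<^sub>p = (\<lambda>x. r * plane_wave k\<^sub>m \<theta>\<^sub>p x)"
    and app: "u\<^sub>a\<^sub>p\<^sub>p = (\<lambda>x. u\<^sub>i x + u\<^sub>p x)"
    and \<gamma>: "\<gamma> = impedance \<omega> \<tau>\<^sub>m r"
  shows "helmholtz_on k\<^sub>m upper_half_space u\<^sub>a\<^sub>p\<^sub>p
    \<and> (r \<noteq> 1 \<longrightarrow> (\<forall>x\<in>boundary_plane.
          u\<^sub>a\<^sub>p\<^sub>p x + \<gamma> * frechet_derivative u\<^sub>a\<^sub>p\<^sub>p (at x) (0, 1) = 0))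
    \<and> outgoing L \<alpha> k\<^sub>m (\<lambda>x. u\<^sub>a\<^sub>p\<^sub>p x - u\<^sub>i x)"
proof -
  have k: "k\<^sub>m > 0"
    using frequency(1,2) material(1) by simp
  have \<omega>\<tau>: "\<omega> * \<tau>\<^sub>m = k\<^sub>m * \<theta>\<^sub>d"
    by (simp add: frequency(2) \<tau>)
  have f: "u\<^sub>a\<^sub>p\<^sub>p = (\<lambda>x. plane_wave k\<^sub>m \<theta>\<^sub>n x + r * plane_wave k\<^sub>m \<theta>\<^sub>p x)"
    unfolding app incident reflected ..
  have "open (upper_half_space :: 'n point set)"
    unfolding upper_half_space_def by (intro open_Collect_less continuous_intros)
  then have "helmholtz_on k\<^sub>m upper_half_space u\<^sub>a\<^sub>p\<^sub>p"
    unfolding f using direction(3,4)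
    by (intro helmholtz_on_add helmholtz_on_cmult helmholtz_on_plane_wave)
  moreover have "u\<^sub>a\<^sub>p\<^sub>p x + \<gamma> * frechet_derivative u\<^sub>a\<^sub>p\<^sub>p (at x) (0, 1) = 0"
    if "r \<noteq> 1" "x \<in> boundary_plane" for x
    unfolding f \<gamma> direction(1,2)
    using that k direction(5) by (intro impedance_condition_incident_plus_reflected \<omega>\<tau>) auto
  moreover have "outgoing L \<alpha> k\<^sub>m (\<lambda>x. u\<^sub>a\<^sub>p\<^sub>p x - u\<^sub>i x)"
  proof -
    have "mode \<alpha> k\<^sub>m 0 = plane_wave k\<^sub>m \<theta>\<^sub>p"
      using mode_0_eq_plane_wave[OF k direction(5)] direction(1,3) unfolding \<alpha> by simp
    then have "(\<lambda>x. u\<^sub>a\<^sub>p\<^sub>p x - u\<^sub>i x) = (\<lambda>x. r * mode \<alpha> k\<^sub>m 0 x)"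
      by (simp add: app reflected)
    then show ?thesis
      using outgoing_single_mode[OF zero_in_dual_lattice] by simp
  qed
  ultimately show ?thesis
    by blast
qed

end
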